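(* Let $(X,\tau)$ and $(Y,\sigma)$ be topological spaces and let $f \colon (X,\tau) \rightarrow (Y,\sigma)$ be a function. The following conditions are equivalent: (1) $f$ is contra-semicontinuous. (2) $f$ is simply-continuous and contra-sg-continuous.
   Context: No separation axioms are assumed and functions are not assumed continuous. For a subset $A$ of a topological space, $\mathrm{Int}(A)$ and $\mathrm{Cl}(A)$ denote interior and closure. $A$ is semi-open if $A \subseteq \mathrm{Cl}(\mathrm{Int}(A))$; semi-closed if its complement is semi-open (equivalently $\mathrm{Int}(\mathrm{Cl}(A)) \subseteq A$). $A$ is simply-open if $A = U \cup N$ with $U$ open and $N$ nowhere dense. The semi-closure $\mathrm{sCl}(A)$ is the intersection of all semi-closed sets containing $A$. $A$ is sg-closed if $\mathrm{sCl}(A) \subseteq U$ whenever $A \subseteq U$ and $U$ is semi-open. A function $f \colon (X,\tau)\to(Y,\sigma)$ is contra-semicontinuous (resp. simply-continuous, contra-sg-continuous) if the preimage of every open subset of $Y$ is semi-closed (resp. simply-open, sg-closed) in $X$. *)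

theory Defs
  imports "HOL-Analysis.Abstract_Topology"
begin

text \<open>
  The \<open>topspace\<close> conjuncts below only say that the set in question is a subset of the space;
  they are omitted where the remaining condition already implies this.
\<close>

definition semi_openin :: "'a topology \<Rightarrow> 'a set \<Rightarrow> bool" where
  "semi_openin X A \<longleftrightarrow> A \<subseteq> X closure_of (X interior_of A)"

definition semi_closedin :: "'a topology \<Rightarrow> 'a set \<Rightarrow> bool" where
  "semi_closedin X A \<longleftrightarrow> A \<subseteq> topspace X \<and> semi_openin X (topspace X - A)"

definition nowhere_dense_in :: "'a topology \<Rightarrow> 'a set \<Rightarrow> bool" where
  "nowhere_dense_in X A \<longleftrightarrow> A \<subseteq> topspace X \<and> X interior_of (X closure_of A) = {}"

definition simply_openin :: "'a topology \<Rightarrow> 'a set \<Rightarrow> bool" where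
  "simply_openin X A \<longleftrightarrow> (\<exists>U N. openin X U \<and> nowhere_dense_in X N \<and> A = U \<union> N)"

text \<open>
  For \<open>A \<subseteq> topspace X\<close> the family intersected here contains \<open>topspace X\<close>, so it is nonempty.
\<close>

definition semi_closure_of :: "'a topology \<Rightarrow> 'a set \<Rightarrow> 'a set"  (infixr \<open>semi'_closure'_of\<close> 80) where
  "X semi_closure_of A = \<Inter>{C. semi_closedin X C \<and> A \<subseteq> C}"

definition sg_closedin :: "'a topology \<Rightarrow> 'a set \<Rightarrow> bool" where
  "sg_closedin X A \<longleftrightarrow>
     A \<subseteq> topspace X \<and> (\<forall>U. semi_openin X U \<and> A \<subseteq> U \<longrightarrow> X semi_closure_of A \<subseteq> U)"

text \<open>
  As for \<^const>\<open>continuous_map\<close>, the preimage of \<open>V\<close> is taken within \<open>topspace X\<close>. Unlike there,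
  the condition that \<open>f\<close> maps \<open>topspace X\<close> into \<open>topspace Y\<close> is not part of the definitions.
\<close>

definition contra_semicontinuous_map :: "'a topology \<Rightarrow> 'b topology \<Rightarrow> ('a \<Rightarrow> 'b) \<Rightarrow> bool" where
  "contra_semicontinuous_map X Y f \<longleftrightarrow>
     (\<forall>V. openin Y V \<longrightarrow> semi_closedin X {x \<in> topspace X. f x \<in> V})"

definition simply_continuous_map :: "'a topology \<Rightarrow> 'b topology \<Rightarrow> ('a \<Rightarrow> 'b) \<Rightarrow> bool" where
  "simply_continuous_map X Y f \<longleftrightarrow>
     (\<forall>V. openin Y V \<longrightarrow> simply_openin X {x \<in> topspace X. f x \<in> V})"

definition contra_sg_continuous_map :: "'a topology \<Rightarrow> 'b topology \<Rightarrow> ('a \<Rightarrow> 'b) \<Rightarrow> bool" where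
  "contra_sg_continuous_map X Y f \<longleftrightarrow>
     (\<forall>V. openin Y V \<longrightarrow> sg_closedin X {x \<in> topspace X. f x \<in> V})"

end

theory Submission
  imports Defs
begin

text \<open>
  The equivalence holds for each set \<open>A\<close> separately: \<open>A\<close> is semi-closed iff it is simply-open and
  sg-closed. If \<open>A\<close> is semi-closed, then it is its own semi-closure, and \<open>A\<close> minus its interior
  lies in \<open>Cl A - Int (Cl A)\<close>, which is nowhere dense. Conversely, let \<open>A = U \<union> N\<close> be sg-closed with
  \<open>U\<close> open and \<open>N\<close> nowhere dense, and suppose \<open>x \<in> Int (Cl A) - A\<close>. As \<open>N\<close> is nowhere dense,
  \<open>x \<in> Cl U\<close>. The singleton \<open>{x}\<close> is either nowhere dense or contained in \<open>Int (Cl {x})\<close>. In the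
  second case \<open>Int (Cl {x})\<close> meets \<open>U\<close>, and so \<open>x \<in> U\<close>, a contradiction. In the first case the
  complement of \<open>{x}\<close> is a semi-open set containing \<open>A\<close>, hence it contains the semi-closure of \<open>A\<close>;
  but \<open>x \<in> Int (Cl A)\<close> lies in every semi-closed set containing \<open>A\<close>.
\<close>

lemma semi_closedin_iff:
  "semi_closedin X A \<longleftrightarrow> A \<subseteq> topspace X \<and> X interior_of (X closure_of A) \<subseteq> A"
proof (cases "A \<subseteq> topspace X")
  case True
  have "X closure_of (X interior_of (topspace X - A))
      = topspace X - X interior_of (X closure_of A)"
    by (simp add: interior_of_complement closure_of_complement)
  moreover have "X interior_of (X closure_of A) \<subseteq> topspace X"
    by (rule interior_of_subset_topspace)
  ultimately show ?thesis
    using True unfolding semi_closedin_def semi_openin_def by auto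
qed (simp add: semi_closedin_def)

lemma interior_of_closure_of_subset_semi_closure_of:
  "X interior_of (X closure_of A) \<subseteq> X semi_closure_of A"
  unfolding semi_closure_of_def
proof (rule Inter_greatest)
  fix C
  assume "C \<in> {C. semi_closedin X C \<and> A \<subseteq> C}"
  then have "X interior_of (X closure_of C) \<subseteq> C" and "A \<subseteq> C"
    by (simp_all add: semi_closedin_iff)
  then show "X interior_of (X closure_of A) \<subseteq> C"
    using interior_of_mono[OF closure_of_mono[of A C X], of X] by blast
qed

lemma semi_closedin_imp_sg_closedin:
  assumes "semi_closedin X A"
  shows "sg_closedin X A"
proof -
  have "X semi_closure_of A \<subseteq> A"
    using assms unfolding semi_closure_of_def by blast
  then show ?thesis
    using assms unfolding sg_closedin_def semi_closedin_def by blast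
qed

lemma nowhere_dense_in_subset_closedin:
  assumes "closedin X C" "X interior_of C = {}" "A \<subseteq> C"
  shows "nowhere_dense_in X A"
proof -
  have "X closure_of A \<subseteq> C"
    using assms by (simp add: closure_of_minimal)
  then have "X interior_of (X closure_of A) = {}"
    using interior_of_mono[of "X closure_of A" C X] assms(2) by blast
  moreover have "A \<subseteq> topspace X"
    using assms(1,3) closedin_subset[of X C] by blast
  ultimately show ?thesis
    by (simp add: nowhere_dense_in_def)
qed

lemma semi_closedin_imp_simply_openin:
  assumes "semi_closedin X A"
  shows "simply_openin X A"
proof -
  \<comment> \<open>\<open>G\<close> is in fact the interior of \<open>A\<close>: it is open and,
    since \<open>A\<close> is semi-closed, lies in \<open>A\<close>.\<close>
  define G where "G = X interior_of (X closure_of A)"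
  define F where "F = X closure_of A - G"
  have A: "A \<subseteq> topspace X" and GA: "G \<subseteq> A"
    using assms by (auto simp: semi_closedin_iff G_def)
  have G: "openin X G"
    by (simp add: G_def)
  have F: "closedin X F"
    using G by (simp add: F_def closedin_diff)
  have "X interior_of F \<subseteq> G"
    unfolding F_def G_def by (rule interior_of_mono) blast
  then have "X interior_of F = {}"
    using interior_of_subset[of X F] unfolding F_def by blast
  moreover have "A - G \<subseteq> F"
    using closure_of_subset[OF A] unfolding F_def by blast
  ultimately have "nowhere_dense_in X (A - G)"
    using F nowhere_dense_in_subset_closedin by blast
  moreover have "A = G \<union> (A - G)"
    using GA by blast
  ultimately show ?thesis
    using G unfolding simply_openin_def by blast
qed

text \<open>Removing \<open>X closure_of U\<close> leaves an open set inside
  \<open>X closure_of N\<close>, whose interior is empty.\<close>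

lemma interior_of_closure_of_Un_nowhere_dense_in:
  assumes "nowhere_dense_in X N"
  shows "X interior_of (X closure_of (U \<union> N)) \<subseteq> X closure_of U"
proof -
  let ?W = "X interior_of (X closure_of (U \<union> N))"
  have "openin X (?W - X closure_of U)"
    by (simp add: openin_diff)
  moreover have "?W - X closure_of U \<subseteq> X closure_of N"
    using interior_of_subset[of X "X closure_of (U \<union> N)"] by (auto simp: closure_of_Un)
  ultimately have "?W - X closure_of U \<subseteq> X interior_of (X closure_of N)"
    by (simp add: interior_of_maximal)
  then show ?thesis
    using assms unfolding nowhere_dense_in_def by blast
qed

text \<open>An open set that misses \<open>x\<close> also misses the closure of \<open>{x}\<close>.
  Hence \<open>{x}\<close> is nowhere dense, and so semi-closed.\<close>

lemma semi_openin_Diff_singleton: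
  assumes "x \<in> topspace X" "x \<notin> X interior_of (X closure_of {x})"
  shows "semi_openin X (topspace X - {x})"
proof -
  have "X interior_of (X closure_of {x}) \<inter> {x} = {}"
    using assms by blast
  then have "X interior_of (X closure_of {x}) \<inter> X closure_of {x} = {}"
    by (simp add: openin_Int_closure_of_eq_empty)
  then have "X interior_of (X closure_of {x}) = {}"
    using interior_of_subset[of X "X closure_of {x}"] by blast
  then have "semi_closedin X {x}"
    using assms by (simp add: semi_closedin_iff)
  then show ?thesis
    by (simp add: semi_closedin_def)
qed

lemma simply_openin_sg_closedin_imp_semi_closedin:
  assumes "simply_openin X A" "sg_closedin X A"
  shows "semi_closedin X A"
proof -
  obtain U N where U: "openin X U" and N: "nowhere_dense_in X N" and A: "A = U \<union> N"
    using assms(1) unfolding simply_openin_def by blast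
  have AX: "A \<subseteq> topspace X"
    using assms(2) by (simp add: sg_closedin_def)
  have "x \<in> A" if x: "x \<in> X interior_of (X closure_of A)" for x
  proof (rule ccontr)
    assume "x \<notin> A"
    have xX: "x \<in> topspace X"
      using x interior_of_subset_topspace[of X "X closure_of A"] by blast
    have xU: "x \<in> X closure_of U"
      using x interior_of_closure_of_Un_nowhere_dense_in[OF N] A by blast
    show False
    proof (cases "x \<in> X interior_of (X closure_of {x})")
      case True
      then obtain y where "y \<in> U" "y \<in> X interior_of (X closure_of {x})"
        using xU openin_interior_of[of X "X closure_of {x}"] unfolding in_closure_of by blast
      \<comment> \<open>\<open>U\<close> is an open neighbourhood of \<open>y\<close>, and
        \<open>y\<close> lies in the closure of \<open>{x}\<close>, so \<open>U\<close> meets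
        \<open>{x}\<close>.\<close>
      then have "x \<in> U"
        using U interior_of_subset[of X "X closure_of {x}"] by (auto simp: in_closure_of)
      then show False
        using A \<open>x \<notin> A\<close> by blast
    next
      case False
      then have "X semi_closure_of A \<subseteq> topspace X - {x}"
        using assms(2) semi_openin_Diff_singleton[OF xX] AX \<open>x \<notin> A\<close>
        unfolding sg_closedin_def by blast
      then show False
        using x interior_of_closure_of_subset_semi_closure_of[of X A] by blast
    qed
  qed
  then show ?thesis
    using AX by (auto simp: semi_closedin_iff)
qed

theorem theorem3p18:
  fixes X :: "'a topology" and Y :: "'b topology" and f :: "'a \<Rightarrow> 'b"
  assumes "f \<in> topspace X \<rightarrow> topspace Y"
  shows "contra_semicontinuous_map X Y f \<longleftrightarrow>
         simply_continuous_map X Y f \<and> contra_sg_continuous_map X Y f"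
  unfolding contra_semicontinuous_map_def simply_continuous_map_def contra_sg_continuous_map_def
  by (meson semi_closedin_imp_simply_openin semi_closedin_imp_sg_closedin
      simply_openin_sg_closedin_imp_semi_closedin)

end
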